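(* Let $G$ be a finite simple connected graph with vertices $v_1,\dots,v_n$. (1) A valuation $f\in T(G)$ maximizes $\tau(G)_f$ over $T(G)$ if and only if there exist constants $\lambda_1,\dots,\lambda_n$ such that for every edge $e$ with endpoints $v_i$ and $v_j$, $\tau(e)=\lambda_i+\lambda_j$. (2) A valuation $f\in C(G)$ maximizes $\tau(G)_f$ over $C(G)$ if and only if for any two vertices $v,w$, $$\deg w\sum_{e \text{ incident to } v}\tau(e)=\deg v\sum_{e \text{ incident to } w}\tau(e).$$
   Context: $P(G)=\{f:E(G)\to(0,\infty) : \sum_{e} f(e)=|E(G)|\}$; $T(G)=\{f\in P(G): \sum_{e \text{ incident to } v} f(e)=\deg v \ \forall v\}$; $C(G)=\{f\in P(G): \exists\, g:V(G)\to(0,\infty),\ f(e_{vw})=g(v)+g(w) \text{ for each edge } e_{vw}\}$. $\tau(G)_f=\sum_{T}\prod_{e\in E(T)} f(e)$ over spanning trees $T$ of $G$, and $\tau(e)=\partial\tau(G)_f/\partial f(e)=\sum_{T\ni e}\prod_{e'\in E(T),\,e'\neq e} f(e')$, evaluated at $f$. *)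

theory Defs
  imports Complex_Main
begin

definition simple_graph :: "'a set \<Rightarrow> 'a set set \<Rightarrow> bool" where
  "simple_graph V E \<longleftrightarrow> finite V \<and> (\<forall>e\<in>E. e \<subseteq> V \<and> card e = 2)"

definition connected_graph :: "'a set \<Rightarrow> 'a set set \<Rightarrow> bool" where
  "connected_graph V E \<longleftrightarrow>
     V \<noteq> {} \<and> (\<forall>u\<in>V. \<forall>w\<in>V. (u, w) \<in> {(x, y). {x, y} \<in> E}\<^sup>*)"

definition incident_edges :: "'a set set \<Rightarrow> 'a \<Rightarrow> 'a set set" where
  "incident_edges E v = {e\<in>E. v \<in> e}"

definition vertex_degree :: "'a set set \<Rightarrow> 'a \<Rightarrow> nat" where
  "vertex_degree E v = card (incident_edges E v)"

text \<open>A cycle is listed by its vertices, without repeating the first one at the end.\<close>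

definition is_cycle :: "'a set set \<Rightarrow> 'a list \<Rightarrow> bool" where
  "is_cycle E xs \<longleftrightarrow> length xs \<ge> 3 \<and> distinct xs \<and>
     (\<forall>i<length xs. {xs ! i, xs ! (Suc i mod length xs)} \<in> E)"

definition is_tree :: "'a set \<Rightarrow> 'a set set \<Rightarrow> bool" where
  "is_tree V E \<longleftrightarrow> simple_graph V E \<and> connected_graph V E \<and> (\<nexists>xs. is_cycle E xs)"

text \<open>Spanning trees have the full vertex set, so they are identified with their edge sets.\<close>

definition spanning_trees :: "'a set \<Rightarrow> 'a set set \<Rightarrow> 'a set set set" where
  "spanning_trees V E = {T. T \<subseteq> E \<and> is_tree V T}"

text \<open>
  A valuation is a total function on vertex sets of which only the values on \<open>E\<close>
  matter: all notions below depend on nothing else.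
\<close>

definition valuations_P :: "'a set set \<Rightarrow> ('a set \<Rightarrow> real) set" where
  "valuations_P E = {f. (\<forall>e\<in>E. f e > 0) \<and> (\<Sum>e\<in>E. f e) = real (card E)}"

definition valuations_T :: "'a set \<Rightarrow> 'a set set \<Rightarrow> ('a set \<Rightarrow> real) set" where
  "valuations_T V E =
     {f \<in> valuations_P E. \<forall>v\<in>V. (\<Sum>e\<in>incident_edges E v. f e) = real (vertex_degree E v)}"

definition valuations_C :: "'a set \<Rightarrow> 'a set set \<Rightarrow> ('a set \<Rightarrow> real) set" where
  "valuations_C V E =
     {f \<in> valuations_P E. \<exists>g :: 'a \<Rightarrow> real. (\<forall>v\<in>V. g v > 0) \<and>
        (\<forall>v w. {v, w} \<in> E \<longrightarrow> f {v, w} = g v + g w)}"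

definition tau :: "'a set \<Rightarrow> 'a set set \<Rightarrow> ('a set \<Rightarrow> real) \<Rightarrow> real" where
  "tau V E f = (\<Sum>T\<in>spanning_trees V E. \<Prod>e\<in>T. f e)"

definition tau_edge :: "'a set \<Rightarrow> 'a set set \<Rightarrow> ('a set \<Rightarrow> real) \<Rightarrow> 'a set \<Rightarrow> real" where
  "tau_edge V E f e = (\<Sum>T\<in>{T\<in>spanning_trees V E. e \<in> T}. \<Prod>e'\<in>T - {e}. f e')"

lemma finite_edges:
  assumes "simple_graph V E"
  shows "finite E"
  using assms unfolding simple_graph_def by (meson PowI finite_Pow_iff finite_subset subsetI)

lemma finite_spanning_trees:
  assumes "simple_graph V E"
  shows "finite (spanning_trees V E)"
proof (rule finite_subset)
  show "spanning_trees V E \<subseteq> Pow E"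
    unfolding spanning_trees_def by blast
  show "finite (Pow E)"
    using finite_edges[OF assms] by simp
qed

text \<open>The edge weight is the partial derivative of \<^const>\<open>tau\<close> in the coordinate \<open>e\<close>.\<close>

lemma tau_has_partial_derivative:
  assumes "simple_graph V E"
  shows "((\<lambda>x. tau V E (f(e := x))) has_real_derivative tau_edge V E f e) (at (f e))"
proof -
  define D where "D T = (if e \<in> T then \<Prod>e'\<in>T - {e}. f e' else 0)" for T
  have fin: "finite (spanning_trees V E)"
    by (rule finite_spanning_trees[OF assms])
  have "((\<lambda>x. \<Prod>e'\<in>T. (f(e := x)) e') has_real_derivative D T) (at (f e))"
    if T: "T \<in> spanning_trees V E" for T
  proof (cases "e \<in> T")
    case True
    have "finite T"
      using T finite_edges by (auto simp: spanning_trees_def is_tree_def)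
    hence "(\<Prod>e'\<in>T. (f(e := x)) e') = x * (\<Prod>e'\<in>T - {e}. f e')" for x
      using True by (subst prod.remove[of T e]) (auto intro!: prod.cong)
    thus ?thesis
      using True by (auto simp: D_def intro!: derivative_eq_intros)
  next
    case False
    hence "(\<Prod>e'\<in>T. (f(e := x)) e') = (\<Prod>e'\<in>T. f e')" for x
      by (intro prod.cong) auto
    thus ?thesis
      using False by (simp add: D_def)
  qed
  hence "((\<lambda>x. tau V E (f(e := x))) has_real_derivative (\<Sum>T\<in>spanning_trees V E. D T)) (at (f e))"
    unfolding tau_def by (intro DERIV_sum) auto
  also have "(\<Sum>T\<in>spanning_trees V E. D T) = tau_edge V E f e"
    unfolding tau_edge_def D_def using fin by (simp add: sum.inter_filter)
  finally show ?thesis .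
qed

end

theory Submission
  imports Defs
begin

text \<open>
  Both \<^term>\<open>valuations_T V E\<close> and the parameter set of \<^term>\<open>valuations_C V E\<close> are relatively
  open in affine subspaces, and the two conditions say that \<^term>\<open>f\<close> is a critical point (Lagrange
  multipliers). It remains to see that critical points are global maxima, which follows from
  log-concavity. Enlarge a root set \<open>R\<close> vertex by vertex: the sum over spanning forests rooted
  at \<open>R\<close> divided by the one rooted at \<open>R \<union> {u}\<close> is the effective conductance
  between \<open>u\<close> and \<open>R\<close> (Kirchhoff), hence by Dirichlet's principle a minimum of functions
  linear in the weights. Thus \<^term>\<open>tau V E\<close> is a product of concave functions of the weights.
\<close>

subsection \<open>Rooted spanning forests\<close>

definition adj :: "'a set set \<Rightarrow> ('a \<times> 'a) set" where
  "adj F = {(x, y). {x, y} \<in> F}"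

definition reach :: "'a set set \<Rightarrow> 'a set \<Rightarrow> 'a set" where
  "reach F R = (adj F)\<^sup>* `` R"

text \<open>Spanning forests with exactly one vertex of \<open>R\<close> in each component, for
  \<open>R\<close> inside \<open>V\<close>. Reaching all of \<open>V\<close> from \<open>R\<close>
  takes at least \<open>card V - card R\<close> edges, so the equation forces minimality and thereby
  rules out cycles and paths between roots.\<close>

definition rooted_forests :: "'a set \<Rightarrow> 'a set set \<Rightarrow> 'a set \<Rightarrow> 'a set set set" where
  "rooted_forests V E R = {F. F \<subseteq> E \<and> V \<subseteq> reach F R \<and> card F + card R = card V}"

text \<open>By the matrix-tree theorem this is, for \<open>R\<close> inside \<open>V\<close>, the
  minor of the weighted Laplacian left after deleting the rows and columns of
  \<open>R\<close>.\<close>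

definition forest_poly :: "'a set \<Rightarrow> 'a set set \<Rightarrow> ('a set \<Rightarrow> real) \<Rightarrow> 'a set \<Rightarrow> real" where
  "forest_poly V E w R = (\<Sum>F\<in>rooted_forests V E R. \<Prod>e\<in>F. w e)"

section \<open>Reachability and the number of edges it takes\<close>

lemma simple_graph_subset: "simple_graph V E \<Longrightarrow> F \<subseteq> E \<Longrightarrow> simple_graph V F"
  by (auto simp: simple_graph_def)

lemma simple_graph_edgeE:
  assumes "simple_graph V E" "e \<in> E"
  obtains a b where "e = {a, b}" "a \<noteq> b" "a \<in> V" "b \<in> V"
  using assms by (auto simp: simple_graph_def card_2_iff)

lemma reach_mono: "F \<subseteq> F' \<Longrightarrow> R \<subseteq> R' \<Longrightarrow> reach F R \<subseteq> reach F' R'"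
  unfolding reach_def by (intro Image_mono rtrancl_mono) (auto simp: adj_def)

lemma reach_refl: "R \<subseteq> reach F R"
  by (auto simp: reach_def)

lemma reach_step: "a \<in> reach F R \<Longrightarrow> {a, b} \<in> F \<Longrightarrow> b \<in> reach F R"
  by (auto simp: reach_def adj_def intro: rtrancl_into_rtrancl)

lemma reach_least:
  assumes "R \<subseteq> Z" "\<And>a b. {a, b} \<in> F \<Longrightarrow> a \<in> Z \<Longrightarrow> b \<in> Z"
  shows "reach F R \<subseteq> Z"
proof -
  have "adj F `` Z \<subseteq> Z"
    using assms(2) by (auto simp: adj_def)
  hence "(adj F)\<^sup>* `` Z = Z"
    by (rule Image_closed_trancl)
  thus ?thesis
    using assms(1) by (auto simp: reach_def)
qed

text \<open>As \<open>a\<close> is reached anyway, all the new edge can do is to make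
  \<open>b\<close> available: it can be traded for a root. This is contraction of the edge into the
  root set.\<close>

lemma reach_insert_edge:
  assumes "a \<in> reach F R"
  shows "reach (insert {a, b} F) R = reach F (insert b R)"
proof
  show "reach (insert {a, b} F) R \<subseteq> reach F (insert b R)"
  proof (rule reach_least)
    show "R \<subseteq> reach F (insert b R)"
      using reach_refl[of "insert b R" F] by blast
    have "a \<in> reach F (insert b R)" "b \<in> reach F (insert b R)"
      using assms reach_mono[of F F R "insert b R"] reach_refl[of "insert b R" F] by auto
    thus "y \<in> reach F (insert b R)"
      if "{x, y} \<in> insert {a, b} F" "x \<in> reach F (insert b R)" for x y
      using that by (auto simp: doubleton_eq_iff intro: reach_step)
  qed
  have "a \<in> reach (insert {a, b} F) R"
    using assms reach_mono[of F "insert {a, b} F" R R] by blast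
  hence "insert b R \<subseteq> reach (insert {a, b} F) R"
    using reach_refl[of R] by (auto intro: reach_step)
  moreover have "y \<in> reach (insert {a, b} F) R"
    if "{x, y} \<in> F" "x \<in> reach (insert {a, b} F) R" for x y
    using that by (auto intro: reach_step)
  ultimately show "reach F (insert b R) \<subseteq> reach (insert {a, b} F) R"
    by (intro reach_least)
qed

text \<open>Trade the edges one at a time for at most one additional root each; once no edge is
  left, only the roots themselves are reached.\<close>

lemma card_le_reach:
  assumes "finite F" "finite R" "\<forall>e\<in>F. card e = 2" "V \<subseteq> reach F R"
  shows "card V \<le> card R + card F"
  using assms
proof (induction F arbitrary: R rule: finite_induct)
  case empty
  have "reach {} R \<subseteq> R"
    by (rule reach_least) auto
  thus ?case
    using empty.prems by (simp add: card_mono)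
next
  case (insert e F)
  obtain a b where e: "e = {a, b}"
    using insert.prems by (metis card_2_iff insertI1)
  \<comment> \<open>If neither end is reached, the edge is useless, and any extra root, here
    \<open>a\<close>, keeps the inclusion true.\<close>
  have "\<exists>c. reach (insert e F) R \<subseteq> reach F (insert c R)"
  proof (cases "a \<in> reach F R \<or> b \<in> reach F R")
    case True
    thus ?thesis
      using reach_insert_edge[of a F R b] reach_insert_edge[of b F R a]
      by (auto simp: e insert_commute)
  next
    case False
    have "reach (insert e F) R \<subseteq> reach F R"
      using False by (intro reach_least reach_refl)
        (auto simp: e doubleton_eq_iff intro: reach_step)
    thus ?thesis
      using reach_mono[of F F R "insert a R"] by blast
  qed
  then obtain c where "V \<subseteq> reach F (insert c R)"
    using insert.prems by blast
  hence "card V \<le> card (insert c R) + card F"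
    using insert.prems by (intro insert.IH) auto
  thus ?case
    using insert.prems insert.hyps card_insert_le_m1[of "Suc (card R)" R c] by (simp add: card_insert_if split: if_splits)
qed

lemma exists_crossing_edge:
  assumes "V \<subseteq> reach E R" "\<not> V \<subseteq> R"
  shows "\<exists>a b. {a, b} \<in> E \<and> a \<in> R \<and> b \<notin> R"
  using assms reach_least[of R R E] by blast

section \<open>Deletion and contraction for forest sums\<close>

lemma finite_rooted_forests: "finite E \<Longrightarrow> finite (rooted_forests V E R)"
  by (rule finite_subset[of _ "Pow E"]) (auto simp: rooted_forests_def)

lemma forest_poly_nonneg:
  assumes "\<forall>e\<in>E. w e \<ge> 0"
  shows "forest_poly V E w R \<ge> 0"
  using assms unfolding forest_poly_def rooted_forests_def
  by (intro sum_nonneg prod_nonneg) auto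

text \<open>No rooted forest uses an edge between two roots: dropping it would lose no vertex and
  leave fewer edges than \<open>card_le_reach\<close> allows.\<close>

lemma forest_poly_root_edge:
  assumes "simple_graph V E" "R \<subseteq> V" "e \<in> E" "e \<subseteq> R"
  shows "forest_poly V (E - {e}) w R = forest_poly V E w R"
proof -
  have "e \<notin> F" if F: "F \<in> rooted_forests V E R" for F
  proof
    assume eF: "e \<in> F"
    obtain a b where e: "e = {a, b}"
      using assms simple_graph_edgeE by metis
    have fin: "finite F" "finite R"
      using F finite_edges[OF assms(1)] assms finite_subset
      by (auto simp: rooted_forests_def simple_graph_def)
    have "a \<in> reach (F - {e}) R"
      using reach_refl[of R] assms(4) by (auto simp: e)
    hence "reach F R = reach (F - {e}) (insert b R)"
      using reach_insert_edge[of a "F - {e}" R b] eF by (simp add: e insert_absorb)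
    moreover have "insert b R = R"
      using assms(4) by (auto simp: e)
    ultimately have "card V \<le> card R + card (F - {e})"
      using F fin assms(1) by (intro card_le_reach) (auto simp: rooted_forests_def simple_graph_def)
    moreover have "card (F - {e}) < card F"
      using fin eF by (intro card_Diff1_less)
    ultimately show False
      using F by (simp add: rooted_forests_def)
  qed
  hence "rooted_forests V (E - {e}) R = rooted_forests V E R"
    by (auto simp: rooted_forests_def)
  thus ?thesis
    by (simp add: forest_poly_def)
qed

text \<open>Forests avoiding the edge are those of the smaller graph; from the others the edge is
  removed and its end \<open>u\<close> becomes a root.\<close>

lemma forest_poly_deletion:
  assumes "simple_graph V E" "R \<subseteq> V" "{r, u} \<in> E" "r \<in> R" "u \<notin> R"
  shows "forest_poly V E w R =
    forest_poly V (E - {{r, u}}) w R + w {r, u} * forest_poly V E w (insert u R)"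
proof -
  let ?e = "{r, u}"
  let ?A = "rooted_forests V (E - {?e}) R"
  let ?B = "rooted_forests V (E - {?e}) (insert u R)"
  have finE: "finite E"
    using assms(1) by (rule finite_edges)
  have finR: "finite R"
    using assms by (auto simp: simple_graph_def intro: finite_subset)
  have u: "u \<in> V"
    using assms by (auto simp: simple_graph_def)
  \<comment> \<open>One edge less and one root more leave the count in \<open>rooted_forests\<close>
    unchanged.\<close>
  have eq: "insert ?e F \<in> rooted_forests V E R \<longleftrightarrow> F \<in> ?B" if F: "F \<subseteq> E - {?e}" for F
  proof -
    have "r \<in> reach F R"
      using reach_refl[of R F] assms by blast
    hence "reach (insert ?e F) R = reach F (insert u R)"
      by (rule reach_insert_edge)
    moreover have "finite F"
      using F finE finite_subset by blast
    moreover have "?e \<notin> F"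
      using F by auto
    ultimately show ?thesis
      using F assms finR by (auto simp: rooted_forests_def)
  qed
  have BS: "F \<subseteq> E - {?e}" if "F \<in> ?B" for F
    using that by (auto simp: rooted_forests_def)
  have un: "rooted_forests V E R = ?A \<union> insert ?e ` ?B"
  proof (intro equalityI subsetI)
    fix F assume F: "F \<in> rooted_forests V E R"
    show "F \<in> ?A \<union> insert ?e ` ?B"
    proof (cases "?e \<in> F")
      case True
      hence "F - {?e} \<in> ?B"
        using F eq[of "F - {?e}"] by (auto simp: insert_absorb rooted_forests_def)
      moreover have "F = insert ?e (F - {?e})"
        using True by auto
      ultimately show ?thesis by blast
    qed (use F in \<open>auto simp: rooted_forests_def\<close>)
  next
    fix F assume "F \<in> ?A \<union> insert ?e ` ?B"
    thus "F \<in> rooted_forests V E R"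
    proof
      assume "F \<in> insert ?e ` ?B"
      then obtain F' where "F' \<in> ?B" "F = insert ?e F'"
        by blast
      thus ?thesis
        using eq[OF BS] by blast
    qed (auto simp: rooted_forests_def)
  qed
  have "forest_poly V E w R =
      (\<Sum>F\<in>?A. \<Prod>e\<in>F. w e) + (\<Sum>F\<in>insert ?e ` ?B. \<Prod>e\<in>F. w e)"
    unfolding forest_poly_def un
    by (rule sum.union_disjoint) (use finE finite_rooted_forests in \<open>auto simp: rooted_forests_def\<close>)
  also have "(\<Sum>F\<in>insert ?e ` ?B. \<Prod>e\<in>F. w e) = (\<Sum>F\<in>?B. \<Prod>e\<in>insert ?e F. w e)"
  proof (subst sum.reindex)
    show "inj_on (insert ?e) ?B"
      using BS by (intro inj_onI) (metis Diff_iff insertI1 insert_ident subsetD)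
  qed simp
  also have "\<dots> = (\<Sum>F\<in>?B. w ?e * (\<Prod>e\<in>F. w e))"
    using BS finE by (intro sum.cong refl prod.insert) (auto intro: finite_subset)
  also have "\<dots> = w ?e * forest_poly V (E - {?e}) w (insert u R)"
    by (simp add: forest_poly_def sum_distrib_left)
  \<comment> \<open>After contraction the edge joins two roots, so it can be put back; the
    contracted term then refers to \<open>E\<close> itself.\<close>
  also have "forest_poly V (E - {?e}) w (insert u R) = forest_poly V E w (insert u R)"
    using assms u by (intro forest_poly_root_edge) auto
  finally show ?thesis
    by (simp add: forest_poly_def)
qed

lemma forest_poly_eq_0:
  assumes "\<not> V \<subseteq> R" "\<And>a b. {a, b} \<in> E \<Longrightarrow> a \<in> R \<Longrightarrow> b \<in> R"
  shows "forest_poly V E w R = 0"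
proof -
  have "rooted_forests V E R = {}"
    using assms exists_crossing_edge[of V _ R] unfolding rooted_forests_def by blast
  thus ?thesis
    by (simp add: forest_poly_def)
qed

text \<open>Promote a vertex across an edge leaving \<open>R\<close> to a root, take a forest for
  the larger root set and add that edge.\<close>

lemma exists_rooted_forest:
  assumes "simple_graph V E" "R \<subseteq> V" "V \<subseteq> reach E R"
  shows "\<exists>F. F \<in> rooted_forests V E R"
  using assms(2,3)
proof (induction "card (V - R)" arbitrary: R)
  case 0
  have "finite V"
    using assms(1) by (simp add: simple_graph_def)
  hence "V = R"
    using 0 by auto
  thus ?case
    using reach_refl[of R "{}"] by (intro exI[of _ "{}"]) (auto simp: rooted_forests_def)
next
  case (Suc n)
  have fin: "finite V" "finite R"
    using assms(1) Suc.prems finite_subset by (auto simp: simple_graph_def)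
  have "V - R \<noteq> {}"
    using Suc.hyps(2) by force
  hence "\<not> V \<subseteq> R"
    by blast
  then obtain r u where ru: "{r, u} \<in> E" "r \<in> R" "u \<notin> R"
    using exists_crossing_edge[OF Suc.prems(2)] by blast
  have u: "u \<in> V"
    using ru assms by (auto simp: simple_graph_def)
  have "card (V - insert u R) = card (V - R) - 1"
    using u ru by (subst Diff_insert) (simp add: card_Diff_singleton)
  hence "n = card (V - insert u R)"
    using Suc.hyps(2) by linarith
  moreover have "V \<subseteq> reach E (insert u R)"
    using Suc.prems(2) reach_mono[of E E R "insert u R"] by blast
  ultimately obtain F where F: "F \<in> rooted_forests V E (insert u R)"
    using Suc.hyps(1)[of "insert u R"] Suc.prems u by auto
  have "finite F"
    using F finite_edges[OF assms(1)] finite_subset by (auto simp: rooted_forests_def)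
  have "r \<in> reach F R"
    using ru reach_refl[of R] by auto
  hence eq: "reach (insert {r, u} F) R = reach F (insert u R)"
    by (rule reach_insert_edge)
  \<comment> \<open>The lower bound excludes that \<open>{r, u}\<close> already lies in
    \<open>F\<close>, in which case adding it would not raise the edge count.\<close>
  have "card V \<le> card R + card (insert {r, u} F)"
    using F fin ru assms(1) \<open>finite F\<close> eq
    by (intro card_le_reach) (auto simp: rooted_forests_def simple_graph_def)
  hence "insert {r, u} F \<in> rooted_forests V E R"
    using F ru fin eq \<open>finite F\<close> by (auto simp: rooted_forests_def card_insert_if split: if_splits)
  thus ?case ..
qed

section \<open>Spanning trees as forests with a single root\<close>

lemma adj_rtrancl_sym: "(a, b) \<in> (adj F)\<^sup>* \<Longrightarrow> (b, a) \<in> (adj F)\<^sup>*"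
  using sym_rtrancl[of "adj F"] by (auto simp: sym_def adj_def insert_commute)

text \<open>Extend the path step by step; when a step returns to a vertex already listed, cut the
  path off at that vertex.\<close>

lemma rtrancl_distinct_path:
  assumes "(a, b) \<in> (adj F)\<^sup>*"
  shows "\<exists>xs. xs \<noteq> [] \<and> distinct xs \<and> hd xs = a \<and> last xs = b \<and>
    (\<forall>i. Suc i < length xs \<longrightarrow> {xs ! i, xs ! Suc i} \<in> F)"
  using assms
proof (induction rule: rtrancl_induct)
  case base
  show ?case
    by (intro exI[of _ "[a]"]) auto
next
  case (step b c)
  then obtain xs where xs: "xs \<noteq> []" "distinct xs" "hd xs = a" "last xs = b"
    "\<forall>i. Suc i < length xs \<longrightarrow> {xs ! i, xs ! Suc i} \<in> F"
    by blast
  show ?case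
  proof (cases "c \<in> set xs")
    case True
    then obtain i where i: "i < length xs" "xs ! i = c"
      by (auto simp: in_set_conv_nth)
    have "last (take (Suc i) xs) = c"
      using i by (simp add: take_Suc_conv_app_nth)
    thus ?thesis
      using xs i by (intro exI[of _ "take (Suc i) xs"]) auto
  next
    case False
    have "{(xs @ [c]) ! i, (xs @ [c]) ! Suc i} \<in> F" if "Suc i < length (xs @ [c])" for i
    proof (cases "Suc i < length xs")
      case True
      thus ?thesis using xs by (auto simp: nth_append)
    next
      case False
      hence "i = length xs - 1" "Suc i = length xs"
        using that by auto
      thus ?thesis
        using step.hyps xs by (auto simp: nth_append last_conv_nth adj_def)
    qed
    thus ?thesis
      using xs False by (intro exI[of _ "xs @ [c]"]) auto
  qed
qed

text \<open>The remaining edges of the cycle join the ends of its closing edge, so every use of that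
  edge can be rerouted.\<close>

lemma cycle_edge_redundant:
  assumes "is_cycle T xs"
  shows "\<exists>e\<in>T. reach (T - {e}) R = reach T R"
proof -
  define n where "n = length xs"
  have n: "n \<ge> 3" "distinct xs" and edge: "\<And>i. i < n \<Longrightarrow> {xs ! i, xs ! (Suc i mod n)} \<in> T"
    using assms by (auto simp: is_cycle_def n_def)
  let ?a = "xs ! 0" and ?b = "xs ! (n - 1)"
  have eT: "{?b, ?a} \<in> T"
    using edge[of "n - 1"] n by simp
  have path: "(?a, xs ! i) \<in> (adj (T - {{?b, ?a}}))\<^sup>*" if "i < n" for i
    using that
  proof (induction i)
    case (Suc i)
    \<comment> \<open>A step of the path equal to the closing edge would force \<open>n = 2\<close>;
      this is where length at least 3 enters.\<close>
    have "{xs ! i, xs ! Suc i} \<noteq> {?b, ?a}"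
    proof
      assume "{xs ! i, xs ! Suc i} = {?b, ?a}"
      hence "Suc i = 0 \<or> i = 0 \<and> Suc i = n - 1"
        using Suc.prems n by (auto simp: doubleton_eq_iff nth_eq_iff_index_eq n_def[symmetric])
      thus False
        using n(1) by linarith
    qed
    hence "(xs ! i, xs ! Suc i) \<in> adj (T - {{?b, ?a}})"
      using edge[of i] Suc.prems by (simp add: adj_def)
    thus ?case
      using Suc by (meson Suc_lessD rtrancl_into_rtrancl)
  qed simp
  have ab: "(?a, ?b) \<in> (adj (T - {{?b, ?a}}))\<^sup>*"
    using path[of "n - 1"] n by simp
  have "reach T R \<subseteq> reach (T - {{?b, ?a}}) R"
  proof (rule reach_least[OF reach_refl])
    fix x y assume xy: "{x, y} \<in> T" "x \<in> reach (T - {{?b, ?a}}) R"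
    show "y \<in> reach (T - {{?b, ?a}}) R"
    proof (cases "{x, y} = {?b, ?a}")
      case True
      hence "(x, y) \<in> (adj (T - {{?b, ?a}}))\<^sup>*"
        using ab adj_rtrancl_sym[OF ab] by (auto simp: doubleton_eq_iff)
      thus ?thesis
        using xy(2) by (auto simp: reach_def intro: rtrancl_trans)
    qed (use xy in \<open>auto intro: reach_step\<close>)
  qed
  thus ?thesis
    using eT reach_mono[of "T - {{?b, ?a}}" T R R] by blast
qed

text \<open>A tree contains a rooted forest, and no edge is missing from it, since it would close a
  cycle. Conversely, a cycle contains a redundant edge, against the minimal edge count of a rooted
  forest.\<close>

lemma spanning_trees_eq_rooted_forests:
  assumes "simple_graph V E" "r \<in> V"
  shows "spanning_trees V E = rooted_forests V E {r}"
proof (intro equalityI subsetI)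
  fix T assume T: "T \<in> spanning_trees V E"
  hence TE: "T \<subseteq> E" and simp: "simple_graph V T" and con: "connected_graph V T"
    and acyc: "\<nexists>xs. is_cycle T xs"
    by (auto simp: spanning_trees_def is_tree_def)
  have "V \<subseteq> reach T {r}"
    using con assms(2) by (auto simp: connected_graph_def reach_def adj_def)
  then obtain F where F: "F \<in> rooted_forests V T {r}"
    using exists_rooted_forest[OF simp, of "{r}"] assms(2) by auto
  have "T \<subseteq> F"
  proof (rule ccontr)
    assume "\<not> T \<subseteq> F"
    then obtain e where e: "e \<in> T" "e \<notin> F"
      by blast
    obtain a b where ab: "e = {a, b}" "a \<noteq> b" "a \<in> V" "b \<in> V"
      using simple_graph_edgeE[OF simp e(1)] .
    have "(r, a) \<in> (adj F)\<^sup>*" "(r, b) \<in> (adj F)\<^sup>*"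
      using F ab by (auto simp: rooted_forests_def reach_def)
    hence "(a, b) \<in> (adj F)\<^sup>*"
      using adj_rtrancl_sym rtrancl_trans by metis
    then obtain xs where xs: "xs \<noteq> []" "distinct xs" "hd xs = a" "last xs = b"
      "\<forall>i. Suc i < length xs \<longrightarrow> {xs ! i, xs ! Suc i} \<in> F"
      using rtrancl_distinct_path by metis
    have hl: "xs ! 0 = a" "xs ! (length xs - 1) = b"
      using xs by (auto simp: hd_conv_nth last_conv_nth)
    have "length xs \<noteq> 1" "length xs \<noteq> 0"
      using hl ab xs(1) by auto
    \<comment> \<open>A path with two vertices would be the edge \<open>e\<close> itself, which is
      not in \<open>F\<close>.\<close>
    moreover have "length xs \<noteq> 2"
      using hl xs(5)[rule_format, of 0] e ab by auto
    ultimately have len: "length xs \<ge> 3"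
      by linarith
    have "{xs ! i, xs ! (Suc i mod length xs)} \<in> T" if "i < length xs" for i
    proof (cases "Suc i < length xs")
      case True
      thus ?thesis using xs F by (auto simp: rooted_forests_def)
    next
      case False
      hence "i = length xs - 1" "Suc i = length xs"
        using that by auto
      thus ?thesis using hl e ab by (auto simp: insert_commute)
    qed
    hence "is_cycle T xs"
      using len xs by (auto simp: is_cycle_def)
    thus False using acyc by blast
  qed
  hence "F = T"
    using F by (auto simp: rooted_forests_def)
  thus "T \<in> rooted_forests V E {r}"
    using F TE by (auto simp: rooted_forests_def)
next
  fix T assume T: "T \<in> rooted_forests V E {r}"
  hence simp: "simple_graph V T"
    using assms simple_graph_subset by (auto simp: rooted_forests_def)
  have fin: "finite T"
    using simp by (rule finite_edges)
  have "(r, v) \<in> (adj T)\<^sup>*" if "v \<in> V" for v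
    using T that by (auto simp: rooted_forests_def reach_def)
  hence "(v, w) \<in> (adj T)\<^sup>*" if "v \<in> V" "w \<in> V" for v w
    using that adj_rtrancl_sym rtrancl_trans by metis
  hence con: "connected_graph V T"
    using assms(2) by (auto simp: connected_graph_def adj_def)
  have "\<not> is_cycle T xs" for xs
  proof
    assume "is_cycle T xs"
    then obtain e where e: "e \<in> T" "reach (T - {e}) {r} = reach T {r}"
      using cycle_edge_redundant by metis
    have "card V \<le> card {r} + card (T - {e})"
      using e T simp fin by (intro card_le_reach) (auto simp: rooted_forests_def simple_graph_def)
    moreover have "card (T - {e}) < card T"
      using fin e by (intro card_Diff1_less)
    ultimately show False
      using T by (simp add: rooted_forests_def)
  qed
  thus "T \<in> spanning_trees V E"
    using con simp T by (auto simp: spanning_trees_def is_tree_def rooted_forests_def)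
qed

subsection \<open>Dirichlet energy and effective conductance\<close>

text \<open>Orthogonal projection onto the span of the \<open>b j\<close>, by Gram-Schmidt. The form
  is only semidefinite when weights vanish, so the Gram matrix may be singular. It yields voltages
  for edge weights and Lagrange multipliers for unit weights.\<close>

lemma exists_orthogonal_residual:
  fixes b :: "'i \<Rightarrow> 'e \<Rightarrow> real" and w :: "'e \<Rightarrow> real"
  assumes "finite E" "finite S" "\<forall>e\<in>E. w e \<ge> 0"
  shows "\<exists>lam. \<forall>i\<in>S. (\<Sum>e\<in>E. w e * (c e - (\<Sum>j\<in>S. lam j * b j e)) * b i e) = 0"
  using assms(2)
proof (induction S arbitrary: c rule: finite_induct)
  case (insert v S)
  define ip where "ip x y = (\<Sum>e\<in>E. w e * x e * y e)" for x y :: "'e \<Rightarrow> real"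
  have lin: "ip (\<lambda>e. x e - t * y e) z = ip x z - t * ip y z" for x y z t
    by (simp add: ip_def algebra_simps sum_subtractf sum_distrib_left)
  have lin': "ip z (\<lambda>e. x e - (\<Sum>j\<in>S. m j * y j e)) = ip z x - (\<Sum>j\<in>S. m j * ip z (y j))"
    for x z m and y :: "'i \<Rightarrow> 'e \<Rightarrow> real"
  proof -
    have "(\<Sum>e\<in>E. w e * z e * (\<Sum>j\<in>S. m j * y j e)) = (\<Sum>j\<in>S. m j * (\<Sum>e\<in>E. w e * z e * y j e))"
      unfolding sum_distrib_left by (subst sum.swap) (simp add: mult_ac)
    thus ?thesis
      by (simp add: ip_def right_diff_distrib sum_subtractf)
  qed
  obtain lam where lam: "\<forall>i\<in>S. ip (\<lambda>e. c e - (\<Sum>j\<in>S. lam j * b j e)) (b i) = 0"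
    using insert.IH[of c] unfolding ip_def by blast
  obtain mu where mu: "\<forall>i\<in>S. ip (\<lambda>e. b v e - (\<Sum>j\<in>S. mu j * b j e)) (b i) = 0"
    using insert.IH[of "b v"] unfolding ip_def by blast
  \<comment> \<open>\<open>p\<close> and \<open>d\<close> are the residuals of \<open>c\<close> and
    of \<open>b v\<close> with respect to \<open>S\<close>; subtracting from \<open>p\<close> its
    component along \<open>d\<close> gives the residual for \<open>insert v S\<close>.\<close>
  define p where "p e = c e - (\<Sum>j\<in>S. lam j * b j e)" for e
  define d where "d e = b v e - (\<Sum>j\<in>S. mu j * b j e)" for e
  \<comment> \<open>If \<open>ip d d = 0\<close>, division by zero gives \<open>t = 0\<close>, which
    is the right value: \<open>d\<close> then vanishes wherever the weight does not, so
    \<open>ip p d = 0\<close> too.\<close>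
  define t where "t = ip p d / ip d d"
  have orth: "ip p (b i) = 0" "ip d (b i) = 0" if "i \<in> S" for i
    using lam mu that unfolding p_def[abs_def] d_def[abs_def] by auto
  have "ip p d = t * ip d d"
  proof (cases "ip d d = 0")
    case True
    have "w e * d e * d e = 0" if "e \<in> E" for e
      using True assms that sum_nonneg_eq_0_iff[of E "\<lambda>e. w e * d e * d e"]
      by (simp add: ip_def mult.assoc)
    hence "ip p d = 0"
      unfolding ip_def by (intro sum.neutral) auto
    thus ?thesis using True by simp
  qed (simp add: t_def)
  hence y_d: "ip (\<lambda>e. p e - t * d e) d = 0"
    by (simp add: lin)
  have y_b: "ip (\<lambda>e. p e - t * d e) (b i) = 0" if "i \<in> S" for i
    using orth[OF that] by (simp add: lin)
  have "ip (\<lambda>e. p e - t * d e) d = ip (\<lambda>e. p e - t * d e) (b v)"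
    using y_b unfolding d_def[abs_def] lin' by simp
  hence y_v: "ip (\<lambda>e. p e - t * d e) (b v) = 0"
    using y_d by simp
  define nu where "nu j = (if j = v then t else lam j - t * mu j)" for j
  have "(\<Sum>j\<in>insert v S. nu j * b j e) = t * b v e + (\<Sum>j\<in>S. (lam j - t * mu j) * b j e)" for e
  proof -
    have "(\<Sum>j\<in>S. nu j * b j e) = (\<Sum>j\<in>S. (lam j - t * mu j) * b j e)"
      using insert.hyps by (intro sum.cong) (auto simp: nu_def)
    thus ?thesis
      using insert.hyps by (simp add: nu_def)
  qed
  hence "c e - (\<Sum>j\<in>insert v S. nu j * b j e) = p e - t * d e" for e
    by (simp add: p_def d_def algebra_simps sum_subtractf sum_distrib_left)
  hence "\<forall>i\<in>insert v S. ip (\<lambda>e. c e - (\<Sum>j\<in>insert v S. nu j * b j e)) (b i) = 0"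
    using y_v y_b by simp
  thus ?case
    unfolding ip_def by blast
qed simp

text \<open>The sign depends on an arbitrary orientation of the edge; only products of two differences matter.\<close>

definition edge_diff :: "('a \<Rightarrow> real) \<Rightarrow> 'a set \<Rightarrow> real" where
  "edge_diff x e = x (SOME a. a \<in> e) - x (the_elem (e - {SOME a. a \<in> e}))"

text \<open>The bilinear form of the weighted graph Laplacian.\<close>

definition energy :: "'a set set \<Rightarrow> ('a set \<Rightarrow> real) \<Rightarrow> ('a \<Rightarrow> real) \<Rightarrow> ('a \<Rightarrow> real) \<Rightarrow> real" where
  "energy E w x y = (\<Sum>e\<in>E. w e * edge_diff x e * edge_diff y e)"

definition supported :: "'a set \<Rightarrow> ('a \<Rightarrow> real) \<Rightarrow> bool" where
  "supported S x \<longleftrightarrow> (\<forall>a. a \<notin> S \<longrightarrow> x a = 0)"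

text \<open>The potential with value 1 at \<open>u\<close> and 0 on \<open>R\<close> that obeys
  Kirchhoff's current law at all other vertices, in weak form. It need not be unique. Its energy is
  the effective conductance between \<open>u\<close> and \<open>R\<close>.\<close>

definition voltage :: "'a set \<Rightarrow> 'a set set \<Rightarrow> ('a set \<Rightarrow> real) \<Rightarrow> 'a set \<Rightarrow> 'a \<Rightarrow> ('a \<Rightarrow> real) \<Rightarrow> bool" where
  "voltage V E w R u p \<longleftrightarrow> p u = 1 \<and> supported (V - R) p \<and>
     (\<forall>z. supported (V - insert u R) z \<longrightarrow> energy E w p z = 0)"

text \<open>The quantifiers stand inside the disjunction: the orientation depends on the edge alone,
  so the signs of two differences cancel in a product.\<close>

lemma edge_diff_cases:
  assumes "a \<noteq> b"
  shows "(\<forall>x. edge_diff x {a, b} = x a - x b) \<or> (\<forall>x. edge_diff x {a, b} = x b - x a)"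
proof -
  have "(SOME c. c \<in> {a, b}) \<in> {a, b}"
    by (rule someI[of _ a]) simp
  hence "(SOME c. c \<in> {a, b}) = a \<or> (SOME c. c \<in> {a, b}) = b"
    by simp
  moreover have "{a, b} - {a} = {b}" "{a, b} - {b} = {a}"
    using assms by auto
  ultimately show ?thesis
    unfolding edge_diff_def by (metis the_elem_eq)
qed

lemma edge_diff_lin:
  "edge_diff (\<lambda>a. x a - t * y a) e = edge_diff x e - t * edge_diff y e"
  "edge_diff (\<lambda>a. x a - y a) e = edge_diff x e - edge_diff y e"
  by (simp_all add: edge_diff_def algebra_simps)

lemma energy_lin:
  "energy E w (\<lambda>a. x a - y a) z = energy E w x z - energy E w y z"
  "energy E w (\<lambda>a. x a - t * y a) z = energy E w x z - t * energy E w y z"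
  "energy E w z (\<lambda>a. x a - y a) = energy E w z x - energy E w z y"
  by (simp_all add: energy_def edge_diff_lin algebra_simps sum_subtractf sum_distrib_left)

lemma energy_commute: "energy E w x y = energy E w y x"
  by (simp add: energy_def mult_ac)

lemma energy_delete_edge:
  assumes "finite E" "{a, b} \<in> E" "a \<noteq> b"
  shows "energy E w x y = energy (E - {{a, b}}) w x y + w {a, b} * (x a - x b) * (y a - y b)"
proof -
  have "edge_diff x {a, b} * edge_diff y {a, b} = (x a - x b) * (y a - y b)"
    using edge_diff_cases[OF assms(3)]
  proof
    assume "\<forall>x. edge_diff x {a, b} = x b - x a"
    hence "edge_diff x {a, b} = x b - x a" "edge_diff y {a, b} = y b - y a"
      by auto
    thus ?thesis
      by (simp only:) (simp add: algebra_simps)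
  qed simp
  thus ?thesis
    unfolding energy_def by (subst sum.remove[OF assms(1,2)]) (simp add: mult.assoc)
qed

lemma edge_diff_expand:
  assumes "finite S" "supported S z"
  shows "edge_diff z e = (\<Sum>i\<in>S. z i * edge_diff (\<lambda>a. if a = i then 1 else 0) e)"
proof -
  have eq: "z a = (\<Sum>i\<in>S. z i * (if a = i then 1 else 0))" for a
    using assms by (simp add: supported_def if_distrib cong: if_cong)
  show ?thesis
    unfolding edge_diff_def right_diff_distrib sum_subtractf
    by (intro arg_cong2[where f = "(-)"] eq)
qed

text \<open>Project the indicator of \<open>u\<close> onto the functions living on the vertices
  other than \<open>u\<close> and the roots; the residual is a voltage.\<close>

lemma exists_voltage:
  assumes "simple_graph V E" "\<forall>e\<in>E. w e \<ge> 0" "u \<in> V - R"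
  shows "\<exists>p. voltage V E w R u p"
proof -
  define S where "S = V - insert u R"
  have fin: "finite E" "finite S"
    using finite_edges[OF assms(1)] assms(1) by (auto simp: S_def simple_graph_def)
  define \<delta> where "\<delta> i a = (if a = i then 1 else 0 :: real)" for i a :: 'a
  obtain lam where lam:
    "\<forall>i\<in>S. (\<Sum>e\<in>E. w e * (edge_diff (\<delta> u) e - (\<Sum>j\<in>S. lam j * edge_diff (\<delta> j) e)) * edge_diff (\<delta> i) e) = 0"
    using exists_orthogonal_residual[OF fin assms(2), of "edge_diff (\<delta> u)" "\<lambda>j. edge_diff (\<delta> j)"] by blast
  define y where "y a = (if a \<in> S then lam a else 0)" for a
  define p where "p a = \<delta> u a - y a" for a
  have y: "edge_diff y e = (\<Sum>j\<in>S. lam j * edge_diff (\<delta> j) e)" for e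
    using edge_diff_expand[OF fin(2), of y e] by (simp add: y_def supported_def \<delta>_def[abs_def])
  have orth: "energy E w p (\<delta> i) = 0" if "i \<in> S" for i
    using lam that unfolding energy_def p_def edge_diff_lin y by simp
  have "energy E w p z = 0" if z: "supported S z" for z
  proof -
    have "energy E w p z = (\<Sum>e\<in>E. \<Sum>i\<in>S. w e * edge_diff p e * (z i * edge_diff (\<delta> i) e))"
      unfolding energy_def edge_diff_expand[OF fin(2) z] sum_distrib_left \<delta>_def[abs_def] ..
    also have "\<dots> = (\<Sum>i\<in>S. z i * energy E w p (\<delta> i))"
      unfolding energy_def sum_distrib_left by (subst sum.swap) (simp add: mult_ac)
    finally show ?thesis
      using orth by simp
  qed
  moreover have "p u = 1" "supported (V - R) p"
    using assms(3) by (auto simp: p_def y_def S_def \<delta>_def supported_def)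
  ultimately show ?thesis
    unfolding voltage_def S_def by blast
qed

text \<open>Both sides are the determinant of the energy form restricted to the span of the
  voltages at \<open>u\<close> and at \<open>v\<close>; on each side it is computed with a different order of
  elimination.\<close>

lemma voltage_energy_exchange:
  assumes "u \<in> V - R" "v \<in> V - R" "u \<noteq> v"
    and "voltage V E w R u p" "voltage V E w R v q"
    and "voltage V E w (insert v R) u a" "voltage V E w (insert u R) v b"
  shows "energy E w p p * energy E w b b = energy E w q q * energy E w a a"
proof -
  \<comment> \<open>Schur complement of the 2 by 2 Gram matrix of \<open>a\<close> and
    \<open>b\<close>. It has its own \<open>u\<close> and \<open>v\<close> because it is applied
    again with the two exchanged.\<close>
  have schur: "energy E w p p * energy E w b b =
      energy E w a a * energy E w b b - (energy E w a b)\<^sup>2"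
    if uv: "u \<in> V - R" "v \<in> V - R" "u \<noteq> v" and
      p: "voltage V E w R u p" and
      a: "voltage V E w (insert v R) u a" and b: "voltage V E w (insert u R) v b"
    for u v p a b
  proof -
    let ?S = "V - insert u (insert v R)"
    have eq: "V - insert v (insert u R) = ?S"
      by auto
    \<comment> \<open>\<open>a\<close> has values 1 and 0 at \<open>u\<close> and \<open>v\<close>,
      and \<open>b\<close> has 0 and 1, so the coefficients 1 and \<open>p v\<close> make
      \<open>z\<close> vanish at both vertices.\<close>
    define z where "z = (\<lambda>c. p c - a c - p v * b c)"
    have z: "supported ?S z"
      using uv p a b unfolding voltage_def supported_def z_def by auto
    have za: "energy E w z a = 0" and zb: "energy E w z b = 0"
      using z a b eq by (auto simp: voltage_def energy_commute[of _ _ z])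
    have "energy E w p b = 0"
      using p b uv by (auto simp: voltage_def)
    moreover have "supported (V - insert u R) (\<lambda>c. p c - a c)"
      using p a uv unfolding voltage_def supported_def by auto
    hence "energy E w p (\<lambda>c. p c - a c) = 0"
      using p unfolding voltage_def by blast
    ultimately have 1: "energy E w p p = energy E w p a" "energy E w p b = 0"
      by (auto simp: energy_lin)
    have lin: "energy E w z c = energy E w p c - energy E w a c - p v * energy E w b c" for c
      unfolding z_def by (simp only: energy_lin(2), simp only: energy_lin(1))
    have 2: "energy E w p a = energy E w a a + p v * energy E w a b"
      using lin[of a] za by (simp add: energy_commute[of _ _ b a])
    have 3: "energy E w a b = - (p v * energy E w b b)"
      using lin[of b] zb 1 by simp
    have "energy E w p p * energy E w b b =
        energy E w a a * energy E w b b + energy E w a b * (p v * energy E w b b)"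
      unfolding 1 2 by (simp add: algebra_simps)
    also have "p v * energy E w b b = - energy E w a b"
      using 3 by simp
    finally show ?thesis
      by (simp add: power2_eq_square)
  qed
  show ?thesis
    using schur[of u v p a b] schur[of v u q b a] assms
    by (simp add: mult.commute energy_commute[of _ _ b a])
qed

section \<open>Kirchhoff's formula\<close>

text \<open>The voltage drop along \<open>{r, u}\<close> is 1, so the edge adds exactly its weight
  to the energy, as in the deletion formula. Test functions vanish at both of its ends, so
  \<open>p\<close> stays a voltage after deletion.\<close>

lemma forest_poly_adjacent_root:
  assumes "simple_graph V E" "R \<subseteq> V" "{r, u} \<in> E" "r \<in> R" "u \<notin> R"
    and p: "voltage V E w R u p"
    and IH: "voltage V (E - {{r, u}}) w R u p \<Longrightarrow>
      forest_poly V (E - {{r, u}}) w R =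
        energy (E - {{r, u}}) w p p * forest_poly V (E - {{r, u}}) w (insert u R)"
  shows "forest_poly V E w R = energy E w p p * forest_poly V E w (insert u R)"
proof -
  have u: "u \<in> V" and ne: "r \<noteq> u"
    using assms by (auto simp: simple_graph_def)
  have del: "energy E w x y = energy (E - {{r, u}}) w x y + w {r, u} * (x r - x u) * (y r - y u)" for x y
    using energy_delete_edge[OF finite_edges[OF assms(1)] assms(3) ne] .
  have pv: "p u = 1" "p r = 0"
    using p assms(4) by (auto simp: voltage_def supported_def)
  have "energy (E - {{r, u}}) w p z = energy E w p z" if "supported (V - insert u R) z" for z
    using that assms(4) by (simp add: del supported_def)
  hence "voltage V (E - {{r, u}}) w R u p"
    using p by (simp add: voltage_def)
  note IH = IH[OF this]
  have eq: "forest_poly V (E - {{r, u}}) w (insert u R) = forest_poly V E w (insert u R)"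
    using assms u by (intro forest_poly_root_edge) auto
  show ?thesis
    unfolding forest_poly_deletion[OF assms(1-5)] IH eq
    by (simp add: del pv algebra_simps)
qed

text \<open>Kirchhoff's formula: the ratio of the two forest sums is the effective conductance
  between \<open>u\<close> and \<open>R\<close>.\<close>

lemma forest_poly_voltage:
  assumes "simple_graph V E" "\<forall>e\<in>E. w e \<ge> 0" "R \<subseteq> V" "u \<in> V - R" "voltage V E w R u p"
  shows "forest_poly V E w R = energy E w p p * forest_poly V E w (insert u R)"
  using assms
\<comment> \<open>The outer induction runs over the number of non-roots, the inner one over the
  number of edges with \<open>R\<close> fixed.\<close>
proof (induction "card (V - R)" arbitrary: E R u p rule: less_induct)
  case less
  note outer = less.hyps
  show ?case
    using less.prems
  proof (induction "card E" arbitrary: E u p rule: less_induct)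
    case inner: less
    note simp = inner.prems(1) and nonneg = inner.prems(2)
    have finV: "finite V" and finE: "finite E"
      using simp finite_edges by (auto simp: simple_graph_def)
    \<comment> \<open>Kirchhoff's formula for a vertex adjacent to the roots, from the inner
      hypothesis. The vertex is arbitrary, as it may differ from \<open>u\<close>.\<close>
    have adjacent: "forest_poly V E w R = energy E w q q * forest_poly V E w (insert v R)"
      if "{r, v} \<in> E" "r \<in> R" "v \<in> V - R" "voltage V E w R v q" for r v q
    proof (rule forest_poly_adjacent_root[OF simp \<open>R \<subseteq> V\<close> that(1,2) _ that(4)])
      have "card (E - {{r, v}}) < card E"
        using finE that(1) by (intro card_Diff1_less)
      thus "voltage V (E - {{r, v}}) w R v q \<Longrightarrow> forest_poly V (E - {{r, v}}) w R =
        energy (E - {{r, v}}) w q q * forest_poly V (E - {{r, v}}) w (insert v R)"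
        using inner.hyps[of "E - {{r, v}}" v q] simp nonneg \<open>R \<subseteq> V\<close> that(3)
        by (auto intro: simple_graph_subset)
    qed (use that in auto)
    show ?case
    proof (cases "\<exists>r v. {r, v} \<in> E \<and> r \<in> R \<and> v \<notin> R")
      case False
      \<comment> \<open>Without an edge leaving \<open>R\<close> both sides are 0: \<open>p\<close>
        differs from the indicator of \<open>V - R\<close> by a test function, and that indicator is
        constant along every edge.\<close>
      have "energy E w p p = energy E w p (\<lambda>a. p a - (if a \<in> V - R then 1 else 0))
          + energy E w p (\<lambda>a. if a \<in> V - R then 1 else 0)"
        by (simp add: energy_lin)
      also have "energy E w p (\<lambda>a. p a - (if a \<in> V - R then 1 else 0)) = 0"
        using inner.prems(4,5) by (auto simp: voltage_def supported_def)
      also have "energy E w p (\<lambda>a. if a \<in> V - R then 1 else 0) = 0"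
        unfolding energy_def
      proof (intro sum.neutral ballI)
        fix e assume e: "e \<in> E"
        then obtain a b where ab: "e = {a, b}" "a \<noteq> b" "a \<in> V" "b \<in> V"
          using simple_graph_edgeE[OF simp] by metis
        have "{b, a} \<in> E"
          using e ab by (simp add: insert_commute)
        hence "a \<in> R \<longleftrightarrow> b \<in> R"
          using False e ab by blast
        hence "edge_diff (\<lambda>a. if a \<in> V - R then 1 else 0) e = 0"
          using edge_diff_cases[OF ab(2)] ab by auto
        thus "w e * edge_diff p e * edge_diff (\<lambda>a. if a \<in> V - R then 1 else 0) e = 0"
          by simp
      qed
      finally have "energy E w p p = 0"
        by simp
      moreover have "forest_poly V E w R = 0"
        using False inner.prems(4) by (intro forest_poly_eq_0) auto
      ultimately show ?thesis
        by simp
    next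
      case True
      then obtain r v where rv: "{r, v} \<in> E" "r \<in> R" "v \<notin> R"
        by blast
      have v: "v \<in> V - R"
        using rv simp by (auto simp: simple_graph_def)
      note u = \<open>u \<in> V - R\<close> and p = \<open>voltage V E w R u p\<close>
      show ?thesis
      proof (cases "v = u")
        case True
        thus ?thesis
          using adjacent[OF rv(1,2) v] p by simp
      next
        case False
        \<comment> \<open>Add \<open>u\<close> and \<open>v\<close> to the roots in both orders: the
          formula is known for every step except from \<open>R\<close> to \<open>insert u R\<close>,
          and \<open>voltage_energy_exchange\<close> supplies that one without any division.\<close>
        obtain q a b where q: "voltage V E w R v q"
          and a: "voltage V E w (insert v R) u a" and b: "voltage V E w (insert u R) v b"
          using exists_voltage[OF simp nonneg] u v False by (metis Diff_iff insertE)
        have less: "card (V - insert v R) < card (V - R)" "card (V - insert u R) < card (V - R)"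
          using u v finV by (auto intro!: psubset_card_mono simp del: card_Diff_insert)
        have "forest_poly V E w R = energy E w q q * forest_poly V E w (insert v R)"
          using adjacent[OF rv(1,2) v q] .
        also have "forest_poly V E w (insert v R) =
            energy E w a a * forest_poly V E w (insert u (insert v R))"
          by (rule outer[OF less(1) simp nonneg _ _ a]) (use u v False \<open>R \<subseteq> V\<close> in auto)
        finally have 1: "forest_poly V E w R =
            (energy E w q q * energy E w a a) * forest_poly V E w (insert u (insert v R))"
          by simp
        have 2: "forest_poly V E w (insert u R) =
            energy E w b b * forest_poly V E w (insert v (insert u R))"
          by (rule outer[OF less(2) simp nonneg _ _ b]) (use u v False \<open>R \<subseteq> V\<close> in auto)
        show ?thesis
          unfolding 1 2 voltage_energy_exchange[OF u v False[symmetric] p q a b, symmetric]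
          by (simp add: insert_commute)
      qed
    qed
  qed
qed

section \<open>Log-concavity from Dirichlet's principle\<close>

text \<open>Pythagoras: \<open>y - p\<close> is a test function, hence orthogonal to
  \<open>p\<close>, and its own energy is nonnegative.\<close>

lemma voltage_energy_le:
  assumes "\<forall>e\<in>E. w e \<ge> 0" "voltage V E w R u p" "y u = 1" "supported (V - R) y"
  shows "energy E w p p \<le> energy E w y y"
proof -
  define z where "z = (\<lambda>a. y a - p a)"
  have z: "supported (V - insert u R) z"
    using assms(2-4) unfolding voltage_def supported_def z_def by auto
  hence pz: "energy E w p z = 0"
    using assms(2) by (simp add: voltage_def)
  have "energy E w z z = energy E w y z - energy E w p z"
    by (simp add: z_def energy_lin)
  moreover have "energy E w y z = energy E w y y - energy E w y p"
    by (simp add: z_def energy_lin)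
  moreover have "energy E w p z = energy E w y p - energy E w p p"
    by (simp add: z_def energy_lin energy_commute[of _ _ p y])
  ultimately have "energy E w y y = energy E w p p + energy E w z z"
    using pz by simp
  moreover have "energy E w z z \<ge> 0"
    unfolding energy_def using assms(1) by (intro sum_nonneg) (simp add: mult.assoc)
  ultimately show ?thesis
    by simp
qed

text \<open>In other words, \<open>r\<close> is a supergradient of the logarithm of the forest sum at \<open>f\<close>.\<close>

lemma forest_poly_le_exp:
  assumes "simple_graph V E" "\<forall>e\<in>E. f e > 0" "R \<subseteq> V"
  shows "\<exists>r. \<forall>h. (\<forall>e\<in>E. h e > 0) \<longrightarrow>
    forest_poly V E h R \<le> forest_poly V E f R * exp (\<Sum>e\<in>E. r e * (h e - f e))"
  using assms(3)
proof (induction "card (V - R)" arbitrary: R)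
  case 0
  have "finite V"
    using assms(1) by (simp add: simple_graph_def)
  hence "V = R"
    using 0 by auto
  \<comment> \<open>With every vertex a root only the empty forest remains; the forest sum is
    constant and has supergradient 0.\<close>
  have "F = {}" if "F \<in> rooted_forests V E V" for F
  proof -
    have "finite F"
      using that finite_edges[OF assms(1)] finite_subset by (auto simp: rooted_forests_def)
    thus ?thesis
      using that by (simp add: rooted_forests_def)
  qed
  hence "forest_poly V E h V = forest_poly V E f V" for h
    unfolding forest_poly_def by (intro sum.cong refl) force
  hence "forest_poly V E h R \<le> forest_poly V E f R" for h
    by (metis \<open>V = R\<close> order_refl)
  thus ?case
    by (intro exI[of _ "\<lambda>_. 0"]) simp
next
  case (Suc n)
  have finV: "finite V"
    using assms(1) by (simp add: simple_graph_def)
  have "V - R \<noteq> {}"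
    using Suc.hyps(2) by force
  then obtain u where u: "u \<in> V - R"
    by blast
  have "card (V - insert u R) = card (V - R) - 1"
    using u by (subst Diff_insert) (simp add: card_Diff_singleton)
  hence "n = card (V - insert u R)"
    using Suc.hyps(2) by linarith
  then obtain r where r: "\<And>h. \<forall>e\<in>E. h e > 0 \<Longrightarrow>
    forest_poly V E h (insert u R) \<le>
      forest_poly V E f (insert u R) * exp (\<Sum>e\<in>E. r e * (h e - f e))"
    using Suc.hyps(1)[of "insert u R"] Suc.prems u by auto
  have f: "\<forall>e\<in>E. f e \<ge> 0"
    using assms(2) by (auto intro: less_imp_le)
  obtain p where p: "voltage V E f R u p"
    using exists_voltage[OF assms(1) f u] by blast
  define c where "c = energy E f p p"
  have c0: "c \<ge> 0"
    unfolding c_def energy_def using f by (intro sum_nonneg) (simp add: mult.assoc)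
  \<comment> \<open>The logarithmic derivative at \<open>f\<close> of the energy of the fixed
    potential \<open>p\<close>. If \<open>c = 0\<close>, then \<open>s\<close> is 0, and
    \<open>p\<close> has no voltage drop on any edge, so its energy is 0 for all weights.\<close>
  define s where "s e = (edge_diff p e)\<^sup>2 / c" for e
  have "forest_poly V E h R \<le> forest_poly V E f R * exp (\<Sum>e\<in>E. (r e + s e) * (h e - f e))"
    if h: "\<forall>e\<in>E. h e > 0" for h
  proof -
    have h': "\<forall>e\<in>E. h e \<ge> 0"
      using h by (auto intro: less_imp_le)
    obtain q where q: "voltage V E h R u q"
      using exists_voltage[OF assms(1) h' u] by blast
    \<comment> \<open>\<open>p\<close> is chosen for \<open>f\<close> before \<open>h\<close> is
      given, but it competes in Dirichlet's principle for every \<open>h\<close>. Its energy is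
      linear in \<open>h\<close>, so \<open>1 + x \<le> exp x\<close> bounds it.\<close>
    have "energy E h q q \<le> energy E h p p"
      using p by (intro voltage_energy_le[OF h' q]) (auto simp: voltage_def)
    also have "energy E h p p \<le> c * exp (\<Sum>e\<in>E. s e * (h e - f e))"
    proof (cases "c = 0")
      case True
      have "edge_diff p e = 0" if "e \<in> E" for e
      proof -
        have "f e * edge_diff p e * edge_diff p e = 0"
          using True that f finite_edges[OF assms(1)]
            sum_nonneg_eq_0_iff[of E "\<lambda>e. f e * edge_diff p e * edge_diff p e"]
          by (simp add: c_def energy_def mult.assoc)
        thus ?thesis
          using assms(2) that by auto
      qed
      thus ?thesis
        using True by (simp add: energy_def)
    next
      case False
      have "energy E h p p = c + (\<Sum>e\<in>E. (edge_diff p e)\<^sup>2 * (h e - f e))"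
        by (simp add: c_def energy_def algebra_simps power2_eq_square sum_subtractf)
      also have "\<dots> = c * (1 + (\<Sum>e\<in>E. s e * (h e - f e)))"
        using False by (simp add: s_def distrib_left sum_distrib_left)
      also have "\<dots> \<le> c * exp (\<Sum>e\<in>E. s e * (h e - f e))"
        using c0 by (intro mult_left_mono exp_ge_add_one_self)
      finally show ?thesis .
    qed
    finally have le: "energy E h q q \<le> c * exp (\<Sum>e\<in>E. s e * (h e - f e))" .
    have "forest_poly V E h R = energy E h q q * forest_poly V E h (insert u R)"
      using forest_poly_voltage[OF assms(1) h' Suc.prems u q] .
    also have "\<dots> \<le> (c * exp (\<Sum>e\<in>E. s e * (h e - f e))) *
        (forest_poly V E f (insert u R) * exp (\<Sum>e\<in>E. r e * (h e - f e)))"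
      using le r[OF h] forest_poly_nonneg[OF h'] c0 by (intro mult_mono) auto
    also have "\<dots> = (c * forest_poly V E f (insert u R)) *
        exp (\<Sum>e\<in>E. (r e + s e) * (h e - f e))"
      by (simp add: exp_add distrib_right sum.distrib)
    also have "c * forest_poly V E f (insert u R) = forest_poly V E f R"
      using forest_poly_voltage[OF assms(1) f Suc.prems u p] by (simp add: c_def)
    finally show ?thesis .
  qed
  thus ?case
    by (intro exI[of _ "\<lambda>e. r e + s e"]) blast
qed

subsection \<open>Critical points of the spanning tree polynomial\<close>

lemma spanning_trees_finite_mem:
  assumes "simple_graph V E" "T \<in> spanning_trees V E"
  shows "finite T" "T \<subseteq> E"
  using assms finite_edges by (auto simp: spanning_trees_def is_tree_def)

text \<open>Admissible perturbations change several weights at once, which calls for the directional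
  derivative: product rule for each tree, then exchange of the sums over trees and edges.\<close>

lemma tau_line_has_derivative:
  assumes "simple_graph V E"
  shows "((\<lambda>t. tau V E (\<lambda>e. f e + t * d e)) has_real_derivative
    (\<Sum>e\<in>E. d e * tau_edge V E f e)) (at 0)"
proof -
  let ?D = "\<lambda>T. \<Sum>e\<in>T. d e * (\<Prod>e'\<in>T - {e}. f e')"
  have "((\<lambda>t. \<Prod>e\<in>T. f e + t * d e) has_real_derivative ?D T) (at 0)"
    if "finite T" for T
    using that
  proof (induction T rule: finite_induct)
    case (insert a T)
    have "((\<lambda>t. (f a + t * d a) * (\<Prod>e\<in>T. f e + t * d e)) has_real_derivative
        d a * (\<Prod>e\<in>T. f e) + ?D T * f a) (at 0)"
      by (rule derivative_eq_intros refl insert.IH | simp)+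
    moreover have "d e * (\<Prod>e'\<in>insert a T - {e}. f e') = d e * (\<Prod>e'\<in>T - {e}. f e') * f a"
      if "e \<in> T" for e
    proof -
      have "insert a T - {e} = insert a (T - {e})"
        using insert.hyps that by auto
      thus ?thesis
        using insert.hyps by simp
    qed
    hence "(\<Sum>e\<in>T. d e * (\<Prod>e'\<in>insert a T - {e}. f e')) = ?D T * f a"
      unfolding sum_distrib_right by (intro sum.cong refl)
    ultimately show ?case
      using insert.hyps by simp
  qed simp
  hence "((\<lambda>t. tau V E (\<lambda>e. f e + t * d e)) has_real_derivative
      (\<Sum>T\<in>spanning_trees V E. ?D T)) (at 0)"
    unfolding tau_def using spanning_trees_finite_mem[OF assms] by (intro DERIV_sum) auto
  also have "(\<Sum>T\<in>spanning_trees V E. ?D T) =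
      (\<Sum>T\<in>spanning_trees V E. \<Sum>e\<in>E. if e \<in> T then d e * (\<Prod>e'\<in>T - {e}. f e') else 0)"
    using spanning_trees_finite_mem[OF assms] finite_edges[OF assms]
    by (intro sum.cong[OF refl]) (simp add: sum.inter_restrict[symmetric] Int_absorb1)
  also have "\<dots> = (\<Sum>e\<in>E. d e * tau_edge V E f e)"
    using finite_spanning_trees[OF assms]
    by (subst sum.swap) (auto simp: tau_edge_def sum_distrib_left sum.inter_filter intro!: sum.cong)
  finally show ?thesis .
qed

text \<open>The index type is generic because the lemma serves edge weights as well as vertex
  weights.\<close>

lemma eventually_line_pos:
  fixes f d :: "'e \<Rightarrow> real"
  assumes "finite E" "\<forall>e\<in>E. f e > 0"
  shows "\<forall>\<^sub>F t in nhds 0. \<forall>e\<in>E. f e + t * d e > 0"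
proof (intro eventually_ball_finite assms(1) ballI)
  fix e assume "e \<in> E"
  have "((\<lambda>t. f e + t * d e) \<longlongrightarrow> f e + 0 * d e) (nhds 0)"
    by (intro tendsto_intros filterlim_ident)
  thus "\<forall>\<^sub>F t in nhds 0. f e + t * d e > 0"
    using assms(2) \<open>e \<in> E\<close> by (auto dest: order_tendstoD)
qed

lemma DERIV_eventually_max:
  fixes F :: "real \<Rightarrow> real"
  assumes "(F has_real_derivative D) (at 0)" "\<forall>\<^sub>F t in nhds 0. F t \<le> F 0"
  shows "D = 0"
proof -
  obtain \<epsilon> where "\<epsilon> > 0" "\<forall>t. dist t 0 < \<epsilon> \<longrightarrow> F t \<le> F 0"
    using assms(2) by (auto simp: eventually_nhds_metric)
  thus ?thesis
    using DERIV_local_max[OF assms(1), of \<epsilon>] by (auto simp: dist_real_def)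
qed

text \<open>The supergradient \<open>r\<close> bounds \<open>tau\<close> by an exponential, and the
  bound is attained at \<open>f\<close>. Criticality in the direction of \<open>h\<close> makes this
  exponential trivial, without identifying \<open>r\<close> with the gradient.\<close>

lemma critical_imp_tau_le:
  assumes "simple_graph V E" "V \<noteq> {}" "\<forall>e\<in>E. f e > 0" "\<forall>e\<in>E. h e > 0"
    and crit: "(\<Sum>e\<in>E. (h e - f e) * tau_edge V E f e) = 0"
  shows "tau V E h \<le> tau V E f"
proof -
  obtain v where v: "v \<in> V"
    using assms(2) by blast
  have tau: "tau V E w = forest_poly V E w {v}" for w
    by (simp add: tau_def forest_poly_def spanning_trees_eq_rooted_forests[OF assms(1) v])
  obtain r where r: "\<And>h. \<forall>e\<in>E. h e > 0 \<Longrightarrow>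
      tau V E h \<le> tau V E f * exp (\<Sum>e\<in>E. r e * (h e - f e))"
    using forest_poly_le_exp[OF assms(1,3), of "{v}"] v unfolding tau by blast
  define d where "d e = h e - f e" for e
  define s where "s = (\<Sum>e\<in>E. r e * d e)"
  \<comment> \<open>\<open>F\<close> is nonpositive for small \<open>t\<close> of either sign and 0
    at 0, so its derivative there vanishes.\<close>
  define F where "F t = tau V E (\<lambda>e. f e + t * d e) - tau V E f * exp (t * s)" for t
  have F0: "F 0 = 0"
    by (simp add: F_def)
  have "\<forall>\<^sub>F t in nhds 0. F t \<le> F 0"
    using eventually_line_pos[OF finite_edges[OF assms(1)] assms(3), of d]
  proof eventually_elim
    case (elim t)
    have "(\<Sum>e\<in>E. r e * (t * d e)) = t * s"
      by (simp add: s_def sum_distrib_left mult_ac)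
    thus ?case
      using r[OF elim] F0 by (simp add: F_def)
  qed
  moreover have "(F has_real_derivative - (tau V E f * s)) (at 0)"
  proof -
    have "((\<lambda>t. tau V E (\<lambda>e. f e + t * d e)) has_real_derivative 0) (at 0)"
      using tau_line_has_derivative[OF assms(1), of f d] crit by (simp add: d_def)
    thus ?thesis
      unfolding F_def by (auto intro!: derivative_eq_intros)
  qed
  \<comment> \<open>Either factor suffices: \<open>s = 0\<close> turns the exponential into 1, and
    \<open>tau V E f = 0\<close> makes the bound 0.\<close>
  ultimately have "tau V E f * s = 0"
    using DERIV_eventually_max by fastforce
  moreover have "tau V E h \<le> tau V E f * exp s"
    using r[OF assms(4)] by (simp add: s_def d_def)
  ultimately show ?thesis
    by auto
qed

lemma max_imp_critical:
  assumes "simple_graph V E" "\<forall>\<^sub>F t in nhds 0. tau V E (\<lambda>e. f e + t * d e) \<le> tau V E f"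
  shows "(\<Sum>e\<in>E. d e * tau_edge V E f e) = 0"
  using DERIV_eventually_max[OF tau_line_has_derivative[OF assms(1)]] assms(2) by simp

section \<open>Vertex sums and edge-additive functions\<close>

text \<open>Double counting of incidences. Consequently edge functions with zero vertex sums are
  orthogonal to all edge-additive ones.\<close>

lemma sum_edges_eq_sum_vertices:
  fixes g :: "'a \<Rightarrow> real"
  assumes "simple_graph V E"
  shows "(\<Sum>e\<in>E. d e * (\<Sum>v\<in>e. g v)) = (\<Sum>v\<in>V. g v * (\<Sum>e\<in>incident_edges E v. d e))"
proof -
  have fin: "finite V" "finite E"
    using assms finite_edges[OF assms] by (auto simp: simple_graph_def)
  have "(\<Sum>v\<in>e. g v) = (\<Sum>v\<in>V. if v \<in> e then g v else 0)" if "e \<in> E" for e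
    using assms that fin by (simp add: simple_graph_def sum.inter_restrict[symmetric] Int_absorb1)
  hence "(\<Sum>e\<in>E. d e * (\<Sum>v\<in>e. g v)) = (\<Sum>e\<in>E. \<Sum>v\<in>V. if v \<in> e then g v * d e else 0)"
    by (intro sum.cong refl) (auto simp: sum_distrib_left intro!: sum.cong)
  also have "\<dots> = (\<Sum>v\<in>V. g v * (\<Sum>e\<in>incident_edges E v. d e))"
    using fin by (subst sum.swap)
      (auto simp: incident_edges_def sum_distrib_left sum.inter_filter intro!: sum.cong)
  finally show ?thesis .
qed

lemma sum_edge_endpoints:
  fixes g :: "'a \<Rightarrow> real"
  assumes "simple_graph V E" "{a, b} \<in> E"
  shows "(\<Sum>v\<in>{a, b}. g v) = g a + g b"
proof -
  have "a \<noteq> b"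
    using assms by (auto simp: simple_graph_def)
  thus ?thesis
    by simp
qed

lemma edge_additive_iff:
  fixes g :: "'a \<Rightarrow> real"
  assumes "simple_graph V E"
  shows "(\<forall>v w. {v, w} \<in> E \<longrightarrow> c {v, w} = g v + g w) \<longleftrightarrow> (\<forall>e\<in>E. c e = (\<Sum>v\<in>e. g v))"
proof
  assume c: "\<forall>v w. {v, w} \<in> E \<longrightarrow> c {v, w} = g v + g w"
  show "\<forall>e\<in>E. c e = (\<Sum>v\<in>e. g v)"
  proof
    fix e assume e: "e \<in> E"
    then obtain a b where "e = {a, b}"
      using simple_graph_edgeE[OF assms] by metis
    thus "c e = (\<Sum>v\<in>e. g v)"
      using c e sum_edge_endpoints[OF assms] by metis
  qed
qed (use sum_edge_endpoints[OF assms] in auto)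

text \<open>Both valuations have the same total, and a vertex value enters once for each incident
  edge. This is the linear constraint on directions within \<open>valuations_C\<close>.\<close>

lemma sum_valuation_differences:
  assumes "simple_graph V E" "f \<in> valuations_P E" "h \<in> valuations_P E"
    and "\<forall>e\<in>E. h e - f e = (\<Sum>v\<in>e. g v)"
  shows "(\<Sum>v\<in>V. g v * real (vertex_degree E v)) = 0"
proof -
  have "(\<Sum>v\<in>V. g v * real (vertex_degree E v)) = (\<Sum>e\<in>E. \<Sum>v\<in>e. g v)"
    using sum_edges_eq_sum_vertices[OF assms(1), of "\<lambda>_. 1" g] by (simp add: vertex_degree_def)
  also have "\<dots> = (\<Sum>e\<in>E. h e - f e)"
    using assms(4) by (intro sum.cong) auto
  finally show ?thesis
    using assms(2,3) by (simp add: sum_subtractf valuations_P_def)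
qed

section \<open>Maxima with prescribed vertex sums\<close>

text \<open>\<open>h - f\<close> has zero vertex sums, hence is orthogonal to an edge-additive
  gradient.\<close>

lemma T_critical_imp_max:
  assumes "simple_graph V E" "V \<noteq> {}" "f \<in> valuations_T V E" "h \<in> valuations_T V E"
    and lam: "\<forall>e\<in>E. tau_edge V E f e = (\<Sum>v\<in>e. lam v)"
  shows "tau V E h \<le> tau V E f"
proof (rule critical_imp_tau_le[OF assms(1,2)])
  have "(\<Sum>e\<in>E. (h e - f e) * tau_edge V E f e) = (\<Sum>e\<in>E. (h e - f e) * (\<Sum>v\<in>e. lam v))"
    using lam by simp
  also have "\<dots> = (\<Sum>v\<in>V. lam v * (\<Sum>e\<in>incident_edges E v. h e - f e))"
    by (rule sum_edges_eq_sum_vertices[OF assms(1)])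
  also have "\<dots> = 0"
    using assms(3,4) by (intro sum.neutral) (simp add: valuations_T_def sum_subtractf)
  finally show "(\<Sum>e\<in>E. (h e - f e) * tau_edge V E f e) = 0" .
qed (use assms(3,4) in \<open>auto simp: valuations_T_def valuations_P_def\<close>)

text \<open>Project the gradient onto the edge-additive functions. The residual \<open>d\<close> is
  an admissible direction, and the derivative along it is the squared norm of \<open>d\<close>, so
  \<open>d\<close> vanishes on \<open>E\<close>.\<close>

lemma T_max_imp_critical:
  assumes "simple_graph V E" "f \<in> valuations_T V E"
    and max: "\<forall>h\<in>valuations_T V E. tau V E h \<le> tau V E f"
  shows "\<exists>lam :: 'a \<Rightarrow> real. \<forall>e\<in>E. tau_edge V E f e = (\<Sum>v\<in>e. lam v)"
proof -
  have fin: "finite V" "finite E"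
    using assms(1) finite_edges[OF assms(1)] by (auto simp: simple_graph_def)
  define inc where "inc v e = (if v \<in> e then 1 else 0 :: real)" for v and e :: "'a set"
  obtain lam where lam: "\<forall>v\<in>V. (\<Sum>e\<in>E. 1 * (tau_edge V E f e - (\<Sum>j\<in>V. lam j * inc j e)) * inc v e) = 0"
    using exists_orthogonal_residual[OF fin(2,1), of "\<lambda>_. 1" "tau_edge V E f" inc] by auto
  define d where "d e = tau_edge V E f e - (\<Sum>v\<in>e. lam v)" for e
  have ends: "(\<Sum>j\<in>V. lam j * inc j e) = (\<Sum>v\<in>e. lam v)" if "e \<in> E" for e
  proof -
    have "(\<Sum>j\<in>V. lam j * inc j e) = (\<Sum>j\<in>V. if j \<in> e then lam j else 0)"
      by (intro sum.cong) (auto simp: inc_def)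
    thus ?thesis
      using assms(1) that fin
      by (simp add: simple_graph_def sum.inter_restrict[symmetric] Int_absorb1)
  qed
  have inc_d: "(\<Sum>e\<in>incident_edges E v. d e) = 0" if "v \<in> V" for v
  proof -
    have "(\<Sum>e\<in>incident_edges E v. d e) = (\<Sum>e\<in>E. if v \<in> e then d e else 0)"
      using fin by (simp add: incident_edges_def sum.inter_filter)
    also have "\<dots> = (\<Sum>e\<in>E. 1 * (tau_edge V E f e - (\<Sum>j\<in>V. lam j * inc j e)) * inc v e)"
      by (intro sum.cong) (auto simp: inc_def[of v] d_def ends)
    finally show ?thesis
      using lam that by simp
  qed
  have d_ends: "(\<Sum>e\<in>E. d e * (\<Sum>v\<in>e. g v)) = 0" for g :: "'a \<Rightarrow> real"
    using inc_d by (simp add: sum_edges_eq_sum_vertices[OF assms(1)])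
  \<comment> \<open>Vertex values 1/2 exhibit the constant 1 as edge-additive, so orthogonality also
    gives total 0 for \<open>d\<close>.\<close>
  have "(\<Sum>v\<in>e. 1 / 2 :: real) = 1" if "e \<in> E" for e
    using assms(1) that by (simp add: simple_graph_def)
  hence sum_d: "(\<Sum>e\<in>E. d e) = 0"
    using d_ends[of "\<lambda>_. 1 / 2"] by simp
  have "\<forall>e\<in>E. f e > 0"
    using assms(2) by (simp add: valuations_T_def valuations_P_def)
  hence "\<forall>\<^sub>F t in nhds 0. \<forall>e\<in>E. f e + t * d e > 0"
    by (rule eventually_line_pos[OF fin(2)])
  hence "\<forall>\<^sub>F t in nhds 0. tau V E (\<lambda>e. f e + t * d e) \<le> tau V E f"
  proof eventually_elim
    case (elim t)
    have "(\<lambda>e. f e + t * d e) \<in> valuations_T V E"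
      using elim assms(2) sum_d inc_d
      by (simp add: valuations_T_def valuations_P_def sum.distrib sum_distrib_left[symmetric])
    thus ?case
      using max by blast
  qed
  hence "(\<Sum>e\<in>E. d e * tau_edge V E f e) = 0"
    by (rule max_imp_critical[OF assms(1)])
  moreover have "d e * d e = d e * tau_edge V E f e - d e * (\<Sum>v\<in>e. lam v)" for e
    by (simp add: d_def[of e] right_diff_distrib)
  ultimately have "(\<Sum>e\<in>E. d e * d e) = 0"
    using d_ends[of lam] by (simp add: sum_subtractf)
  hence "\<forall>e\<in>E. d e = 0"
    using sum_nonneg_eq_0_iff[OF fin(2), of "\<lambda>e. d e * d e"] by simp
  thus ?thesis
    by (intro exI[of _ lam]) (simp add: d_def)
qed

section \<open>Maxima among edge-additive valuations\<close>

text \<open>\<open>h - f\<close> comes from vertex values orthogonal to the degrees, and the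
  condition makes the vertex sums of the gradient proportional to the degrees.\<close>

lemma C_critical_imp_max:
  assumes "simple_graph V E" "V \<noteq> {}" "f \<in> valuations_C V E" "h \<in> valuations_C V E"
    and crit: "\<forall>v\<in>V. \<forall>w\<in>V.
      real (vertex_degree E w) * (\<Sum>e\<in>incident_edges E v. tau_edge V E f e) =
      real (vertex_degree E v) * (\<Sum>e\<in>incident_edges E w. tau_edge V E f e)"
  shows "tau V E h \<le> tau V E f"
proof (rule critical_imp_tau_le[OF assms(1,2)])
  let ?S = "\<lambda>v. \<Sum>e\<in>incident_edges E v. tau_edge V E f e"
  have fin: "finite E"
    using assms(1) by (rule finite_edges)
  obtain g g' where g: "\<forall>e\<in>E. f e = (\<Sum>v\<in>e. g v)" "\<forall>e\<in>E. h e = (\<Sum>v\<in>e. g' v)"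
    using assms(3,4) by (auto simp: valuations_C_def edge_additive_iff[OF assms(1)])
  define \<gamma> where "\<gamma> v = g' v - g v" for v
  have \<gamma>: "\<forall>e\<in>E. h e - f e = (\<Sum>v\<in>e. \<gamma> v)"
    using g by (simp add: \<gamma>_def sum_subtractf)
  have deg: "(\<Sum>v\<in>V. \<gamma> v * real (vertex_degree E v)) = 0"
    using assms(3,4) by (intro sum_valuation_differences[OF assms(1) _ _ \<gamma>]) (auto simp: valuations_C_def)
  have "(\<Sum>e\<in>E. (h e - f e) * tau_edge V E f e) = (\<Sum>e\<in>E. tau_edge V E f e * (\<Sum>v\<in>e. \<gamma> v))"
    using \<gamma> by (simp add: mult.commute)
  also have "\<dots> = (\<Sum>v\<in>V. \<gamma> v * ?S v)"
    by (rule sum_edges_eq_sum_vertices[OF assms(1)])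
  \<comment> \<open>The factor of proportionality is read off at a vertex of nonzero degree; if
    there is none, all vertex sums are empty.\<close>
  also have "\<dots> = 0"
  proof (cases "\<exists>w\<in>V. vertex_degree E w \<noteq> 0")
    case True
    then obtain w where w: "w \<in> V" "vertex_degree E w \<noteq> 0"
      by blast
    have "real (vertex_degree E w) * (\<Sum>v\<in>V. \<gamma> v * ?S v) =
        (\<Sum>v\<in>V. \<gamma> v * (real (vertex_degree E w) * ?S v))"
      by (simp add: sum_distrib_left mult_ac)
    also have "\<dots> = (\<Sum>v\<in>V. \<gamma> v * (real (vertex_degree E v) * ?S w))"
      using crit w(1) by (intro sum.cong) auto
    also have "\<dots> = ?S w * (\<Sum>v\<in>V. \<gamma> v * real (vertex_degree E v))"
      by (simp add: sum_distrib_left mult_ac)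
    finally show ?thesis
      using w(2) deg by simp
  next
    case False
    hence "incident_edges E v = {}" if "v \<in> V" for v
      using that fin by (auto simp: vertex_degree_def incident_edges_def)
    thus ?thesis
      by simp
  qed
  finally show "(\<Sum>e\<in>E. (h e - f e) * tau_edge V E f e) = 0" .
qed (use assms(3,4) in \<open>auto simp: valuations_C_def valuations_P_def\<close>)

text \<open>Raise \<open>g\<close> at \<open>v\<close> at rate \<open>deg w\<close> and lower it at
  \<open>w\<close> at rate \<open>deg v\<close>: the total weight stays fixed, and the derivative of
  \<open>tau\<close> is the difference of the two sides.\<close>

lemma C_max_imp_critical:
  assumes "simple_graph V E" "f \<in> valuations_C V E"
    and max: "\<forall>h\<in>valuations_C V E. tau V E h \<le> tau V E f"
    and vw: "v \<in> V" "w \<in> V"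
  shows "real (vertex_degree E w) * (\<Sum>e\<in>incident_edges E v. tau_edge V E f e) =
    real (vertex_degree E v) * (\<Sum>e\<in>incident_edges E w. tau_edge V E f e)"
proof -
  have fin: "finite V" "finite E"
    using assms(1) finite_edges[OF assms(1)] by (auto simp: simple_graph_def)
  obtain g where g: "\<forall>v\<in>V. g v > 0" "\<forall>e\<in>E. f e = (\<Sum>v\<in>e. g v)"
    using assms(2) by (auto simp: valuations_C_def edge_additive_iff[OF assms(1)])
  \<comment> \<open>Written as a difference of two terms, so that for \<open>v = w\<close> they
    cancel and the direction is 0.\<close>
  define \<gamma> where "\<gamma> x = (if x = v then real (vertex_degree E w) else 0) -
      (if x = w then real (vertex_degree E v) else 0)" for x
  have delta: "(\<Sum>x\<in>V. (if x = y then k else 0) * c x) = k * c y"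
    if "y \<in> V" for y k and c :: "'a \<Rightarrow> real"
  proof -
    have "(\<Sum>x\<in>V. (if x = y then k else 0) * c x) = (\<Sum>x\<in>V. if x = y then k * c y else 0)"
      by (intro sum.cong) auto
    thus ?thesis
      using that fin by simp
  qed
  have \<gamma>: "(\<Sum>x\<in>V. \<gamma> x * c x) = real (vertex_degree E w) * c v - real (vertex_degree E v) * c w" for c
    using vw by (simp add: \<gamma>_def left_diff_distrib sum_subtractf delta)
  define d where "d e = (\<Sum>x\<in>e. \<gamma> x)" for e
  have "(\<Sum>e\<in>E. d e) = (\<Sum>x\<in>V. \<gamma> x * real (vertex_degree E x))"
    using sum_edges_eq_sum_vertices[OF assms(1), of "\<lambda>_. 1" \<gamma>]
    by (simp add: vertex_degree_def d_def)
  hence sum_d: "(\<Sum>e\<in>E. d e) = 0"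
    by (simp add: \<gamma>)
  have "\<forall>e\<in>E. f e > 0"
    using assms(2) by (simp add: valuations_C_def valuations_P_def)
  hence "\<forall>\<^sub>F t in nhds 0. \<forall>e\<in>E. f e + t * d e > 0"
    by (rule eventually_line_pos[OF fin(2)])
  \<comment> \<open>Membership in \<open>valuations_C\<close> also asks for positive vertex values,
    so \<open>t\<close> must be small for \<open>g\<close> as well.\<close>
  moreover have "\<forall>\<^sub>F t in nhds 0. \<forall>x\<in>V. g x + t * \<gamma> x > 0"
    using g(1) by (rule eventually_line_pos[OF fin(1)])
  ultimately have "\<forall>\<^sub>F t in nhds 0. tau V E (\<lambda>e. f e + t * d e) \<le> tau V E f"
  proof eventually_elim
    case (elim t)
    have "\<forall>e\<in>E. f e + t * d e = (\<Sum>x\<in>e. g x + t * \<gamma> x)"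
      using g(2) by (simp add: d_def sum.distrib sum_distrib_left)
    hence "\<exists>g. (\<forall>v\<in>V. g v > 0) \<and> (\<forall>e\<in>E. f e + t * d e = (\<Sum>x\<in>e. g x))"
      using elim(2) by (intro exI[of _ "\<lambda>x. g x + t * \<gamma> x"]) blast
    hence "(\<lambda>e. f e + t * d e) \<in> valuations_C V E"
      using elim(1) assms(2) sum_d
      by (simp add: valuations_C_def valuations_P_def edge_additive_iff[OF assms(1)]
          sum.distrib sum_distrib_left[symmetric])
    thus ?case
      using max by blast
  qed
  hence "(\<Sum>e\<in>E. d e * tau_edge V E f e) = 0"
    by (rule max_imp_critical[OF assms(1)])
  moreover have "(\<Sum>e\<in>E. d e * tau_edge V E f e) =
      (\<Sum>x\<in>V. \<gamma> x * (\<Sum>e\<in>incident_edges E x. tau_edge V E f e))"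
    using sum_edges_eq_sum_vertices[OF assms(1), of "tau_edge V E f" \<gamma>]
    by (simp add: d_def mult.commute)
  ultimately show ?thesis
    by (simp add: \<gamma>)
qed

theorem theorem8:
  fixes V :: "'a set" and E :: "'a set set"
  assumes "simple_graph V E" and "connected_graph V E"
  shows "(\<forall>f\<in>valuations_T V E.
            (\<forall>h\<in>valuations_T V E. tau V E h \<le> tau V E f) \<longleftrightarrow>
            (\<exists>lam :: 'a \<Rightarrow> real. \<forall>v w. {v, w} \<in> E \<longrightarrow>
               tau_edge V E f {v, w} = lam v + lam w)) \<and>
         (\<forall>f\<in>valuations_C V E.
            (\<forall>h\<in>valuations_C V E. tau V E h \<le> tau V E f) \<longleftrightarrow>
            (\<forall>v\<in>V. \<forall>w\<in>V.
               real (vertex_degree E w) * (\<Sum>e\<in>incident_edges E v. tau_edge V E f e) =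
               real (vertex_degree E v) * (\<Sum>e\<in>incident_edges E w. tau_edge V E f e)))"
proof -
  have "V \<noteq> {}"
    using assms(2) by (simp add: connected_graph_def)
  thus ?thesis
    unfolding edge_additive_iff[OF assms(1)]
    using T_critical_imp_max[OF assms(1)] T_max_imp_critical[OF assms(1)]
      C_critical_imp_max[OF assms(1)] C_max_imp_critical[OF assms(1)]
    by (intro conjI ballI iffI) metis+
qed

end
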